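(* Let $0<p<1$, $q=1-p$, and let $(T_n)_{n\ge0}$ be a random recursive tree process with uniform attachment insertion (probability $p$) and a deletion rule (probability $q$) such that the process supports conditional equiprobability. Let $S_n$ be the stratum number of $T_n$ and let $L_n$ be the number of leaves of $T_n$. Then for all $n\ge 0$, $$\mathbb{E}[L_n]=\frac{1+\mathbb{E}[S_n]+\mathbb{P}\{S_n=0\}}{2}.$$
   Context: A recursive tree with $m$ nodes is a rooted tree with nodes labeled $1,\dots,m$, rooted at node $1$, whose labels increase along every path away from the root. The stratum number of a tree is its number of nodes minus one; stratum $k$ is the set of the $k!$ recursive trees with stratum number $k$. A leaf is a node with no children; in particular the single-node tree has exactly one leaf. The process $(T_n)_{n\ge0}$ is a Markov chain on recursive trees. $T_0$ is the single-node tree. At each step, with probability $p$ a new node labeled $k+2$ is attached to a uniformly chosen node of the current stratum $k$ tree (uniform attachment). With probability $q=1-p$ a deletion takes place: a stratum $k+1$ tree is replaced by a stratum $k$ tree according to a deletion rule, i.e. fixed transition probabilities from stratum $k+1$ trees to stratum $k$ trees, $k\ge0$; if the current tree is the single-node tree, it is left unchanged. The process supports conditional equiprobability if for every $n\ge1$, every $k$ with $\mathbb{P}\{S_n=k\}>0$ and every stratum $k$ tree $t$, $\mathbb{P}\{T_n=t\mid S_n=k\}=1/k!$. *)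

theory Defs
  imports "HOL-Probability.Probability"
begin

text \<open>
  Rooted trees are represented by their node set and their set of parent-child arcs,
  each arc being directed away from the root.
\<close>

record labelled_tree =
  nodes :: "nat set"
  arcs :: "(nat \<times> nat) set"

definition rooted_tree :: "nat \<Rightarrow> labelled_tree \<Rightarrow> bool" where
  "rooted_tree r t \<longleftrightarrow>
     finite (nodes t) \<and> r \<in> nodes t \<and> arcs t \<subseteq> nodes t \<times> nodes t \<and>
     (\<forall>u. (u, r) \<notin> arcs t) \<and>
     (\<forall>v \<in> nodes t - {r}. \<exists>!u. (u, v) \<in> arcs t) \<and>
     (\<forall>v \<in> nodes t. (r, v) \<in> (arcs t)\<^sup>*)"

definition recursive_tree :: "nat \<Rightarrow> labelled_tree \<Rightarrow> bool" where
  "recursive_tree m t \<longleftrightarrow>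
     nodes t = {1..m} \<and> rooted_tree 1 t \<and> (\<forall>(u, v) \<in> (arcs t)\<^sup>+. u < v)"

definition recursive_trees :: "labelled_tree set" where
  "recursive_trees = {t. \<exists>m. recursive_tree m t}"

definition single_node_tree :: labelled_tree where
  "single_node_tree = \<lparr>nodes = {1}, arcs = {}\<rparr>"

definition stratum_number :: "labelled_tree \<Rightarrow> nat" where
  "stratum_number t = card (nodes t) - 1"

definition stratum :: "nat \<Rightarrow> labelled_tree set" where
  "stratum k = {t \<in> recursive_trees. stratum_number t = k}"

definition leaves :: "labelled_tree \<Rightarrow> nat set" where
  "leaves t = {v \<in> nodes t. \<forall>w. (v, w) \<notin> arcs t}"

definition attach :: "labelled_tree \<Rightarrow> nat \<Rightarrow> labelled_tree" where
  "attach t v =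
     (let w = stratum_number t + 2 in \<lparr>nodes = insert w (nodes t), arcs = insert (v, w) (arcs t)\<rparr>)"

definition uniform_attachment :: "labelled_tree \<Rightarrow> labelled_tree pmf" where
  "uniform_attachment t = map_pmf (attach t) (pmf_of_set (nodes t))"

definition deletion_rule :: "(labelled_tree \<Rightarrow> labelled_tree pmf) \<Rightarrow> bool" where
  "deletion_rule d \<longleftrightarrow> (\<forall>k. \<forall>t \<in> stratum (Suc k). set_pmf (d t) \<subseteq> stratum k)"

definition step :: "real \<Rightarrow> (labelled_tree \<Rightarrow> labelled_tree pmf) \<Rightarrow> labelled_tree \<Rightarrow> labelled_tree pmf"
  where
  "step p d t =
     bernoulli_pmf p \<bind>
       (\<lambda>insertion. if insertion then uniform_attachment t
                    else if t = single_node_tree then return_pmf t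
                    else d t)"

locale recursive_tree_process = prob_space M
  for M :: "'a measure" +
  fixes p :: real
    and d :: "labelled_tree \<Rightarrow> labelled_tree pmf"
    and T :: "nat \<Rightarrow> 'a \<Rightarrow> labelled_tree"
  assumes deletion_rule: "deletion_rule d"
    and random_tree: "T n \<in> M \<rightarrow>\<^sub>M count_space recursive_trees"
    and initial: "AE \<omega> in M. T 0 \<omega> = single_node_tree"
    and markov: "\<P>(\<omega> in M. \<forall>i\<le>n. T i \<omega> = h i) > 0 \<Longrightarrow>
      \<P>(\<omega> in M. T (Suc n) \<omega> = t \<bar> \<forall>i\<le>n. T i \<omega> = h i) = pmf (step p d (h n)) t"

definition conditionally_equiprobable ::
    "'a measure \<Rightarrow> (nat \<Rightarrow> 'a \<Rightarrow> labelled_tree) \<Rightarrow> bool" where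
  "conditionally_equiprobable M T \<longleftrightarrow>
     (\<forall>n\<ge>1. \<forall>k. \<P>(\<omega> in M. stratum_number (T n \<omega>) = k) > 0 \<longrightarrow>
        (\<forall>t \<in> stratum k.
           \<P>(\<omega> in M. T n \<omega> = t \<bar> stratum_number (T n \<omega>) = k) = 1 / fact k))"

end

theory Submission
  imports Defs
begin

text \<open>
  Summed over the vertices \<open>v\<close> of a tree with \<open>k + 1\<close> nodes and \<open>l\<close> leaves, the number of leaves
  after attaching a new node to \<open>v\<close> is \<open>(k + 1) + k l\<close>. Since attachment is a bijection from
  pairs (tree of stratum \<open>k\<close>, node) onto stratum \<open>k + 1\<close>, induction on \<open>k\<close> shows that a uniform
  tree of stratum \<open>k\<close> has on average \<open>(1 + k + [k = 0]) / 2\<close> leaves. Hence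
  \<open>2 L - (1 + S + [S = 0])\<close> sums to zero over each stratum, and its expectation vanishes under any
  law that is constant on strata. The Markov property yields \<open>S\<^sub>n \<le> n\<close> almost surely, which makes
  every expectation a finite sum.
\<close>

section \<open>Recursive trees and their strata\<close>

text \<open>A local description without transitive closures: increasing arcs give increasing paths,
  and since parents have smaller labels, climbing from any node must end at 1.\<close>

lemma recursive_tree_iff:
  "recursive_tree m t \<longleftrightarrow>
     1 \<le> m \<and> nodes t = {1..m} \<and> (\<forall>(u, v) \<in> arcs t. 1 \<le> u \<and> u < v \<and> v \<le> m) \<and>
     (\<forall>v \<in> {2..m}. \<exists>!u. (u, v) \<in> arcs t)"
  (is "_ \<longleftrightarrow> ?R")
proof
  assume t: "recursive_tree m t"
  then have nodes: "nodes t = {1..m}" and root: "1 \<in> nodes t"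
    and sub: "arcs t \<subseteq> nodes t \<times> nodes t"
    and parent: "\<forall>v \<in> nodes t - {1}. \<exists>!u. (u, v) \<in> arcs t"
    and less: "\<forall>(u, v) \<in> (arcs t)\<^sup>+. u < v"
    by (auto simp: recursive_tree_def rooted_tree_def)
  have "\<forall>(u, v) \<in> arcs t. 1 \<le> u \<and> u < v \<and> v \<le> m"
    using sub less nodes by fastforce
  moreover have "\<forall>v \<in> {2..m}. \<exists>!u. (u, v) \<in> arcs t"
    using parent nodes by auto
  ultimately show ?R
    using nodes root by simp
next
  assume R: ?R
  then have nodes: "nodes t = {1..m}" and "1 \<le> m"
    and arc: "\<And>u v. (u, v) \<in> arcs t \<Longrightarrow> 1 \<le> u \<and> u < v \<and> v \<le> m"
    and parent: "\<And>v. 2 \<le> v \<Longrightarrow> v \<le> m \<Longrightarrow> \<exists>!u. (u, v) \<in> arcs t"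
    by auto
  have less: "u < v" if "(u, v) \<in> (arcs t)\<^sup>+" for u v
    using that by (induction rule: trancl_induct) (use arc in force)+
  \<comment> \<open>Strong induction on the label: the path to the parent is extended by one
    arc.\<close>
  have reach: "(1, v) \<in> (arcs t)\<^sup>*" if "1 \<le> v" "v \<le> m" for v
    using that
  proof (induction v rule: less_induct)
    case (less v)
    show ?case
    proof (cases "v = 1")
      case False
      with less.prems parent[of v] obtain u where u: "(u, v) \<in> arcs t"
        by fastforce
      with arc[OF u] less.IH[of u] less.prems show ?thesis
        by (meson order.trans less_imp_le rtrancl.rtrancl_into_rtrancl)
    qed simp
  qed
  have "\<forall>v \<in> nodes t - {1}. \<exists>!u. (u, v) \<in> arcs t"
    using parent nodes by simp
  moreover have "arcs t \<subseteq> nodes t \<times> nodes t"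
    using arc nodes by fastforce
  moreover have "\<forall>u. (u, 1) \<notin> arcs t"
    using arc by fastforce
  ultimately show "recursive_tree m t"
    using nodes \<open>1 \<le> m\<close> reach less by (auto simp: recursive_tree_def rooted_tree_def)
qed

lemma stratum_iff: "t \<in> stratum k \<longleftrightarrow> recursive_tree (Suc k) t"
proof
  assume "t \<in> stratum k"
  then obtain m where "recursive_tree m t" "stratum_number t = k"
    by (auto simp: stratum_def recursive_trees_def)
  moreover from this have "m = Suc k"
    by (auto simp: recursive_tree_iff stratum_number_def)
  ultimately show "recursive_tree (Suc k) t"
    by simp
next
  assume t: "recursive_tree (Suc k) t"
  then have "stratum_number t = k"
    by (simp add: recursive_tree_iff stratum_number_def)
  with t show "t \<in> stratum k"
    by (auto simp: stratum_def recursive_trees_def)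
qed

lemma nodes_stratum: "t \<in> stratum k \<Longrightarrow> nodes t = {1..Suc k}"
  by (simp add: stratum_iff recursive_tree_iff)

lemma stratum_number_stratum: "t \<in> stratum k \<Longrightarrow> stratum_number t = k"
  by (simp add: stratum_def)

lemma stratum_0: "stratum 0 = {single_node_tree}"
proof -
  have "t = single_node_tree" if "recursive_tree 1 t" for t
  proof -
    have "arcs t = {}"
      using that by (fastforce simp: recursive_tree_iff)
    then show ?thesis
      using that by (simp add: recursive_tree_iff single_node_tree_def)
  qed
  moreover have "recursive_tree 1 single_node_tree"
    by (simp add: recursive_tree_iff single_node_tree_def)
  ultimately show ?thesis
    by (auto simp: stratum_iff)
qed

lemma finite_stratum: "finite (stratum k)"
proof (rule finite_subset)
  show "stratum k \<subseteq> (\<lambda>A. \<lparr>nodes = {1..Suc k}, arcs = A\<rparr>) ` Pow ({1..Suc k} \<times> {1..Suc k})"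
  proof
    fix t assume "t \<in> stratum k"
    then have "nodes t = {1..Suc k}" "arcs t \<subseteq> {1..Suc k} \<times> {1..Suc k}"
      by (auto simp: stratum_iff recursive_tree_def rooted_tree_def)
    moreover from this have "t = \<lparr>nodes = {1..Suc k}, arcs = arcs t\<rparr>"
      by simp
    ultimately show "t \<in> (\<lambda>A. \<lparr>nodes = {1..Suc k}, arcs = A\<rparr>) ` Pow ({1..Suc k} \<times> {1..Suc k})"
      by blast
  qed
qed simp

lemma recursive_trees_eq_Union_stratum: "recursive_trees = (\<Union>k. stratum k)"
  by (auto simp: stratum_def)

lemma countable_recursive_trees: "countable recursive_trees"
  by (auto simp: recursive_trees_eq_Union_stratum intro: countable_finite finite_stratum)

section \<open>Attachment as a bijection between consecutive strata\<close>

lemma attach_in_stratum: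
  assumes "t \<in> stratum k" "v \<in> {1..Suc k}"
  shows "attach t v \<in> stratum (Suc k)"
proof -
  have t: "nodes t = {1..Suc k}" "\<And>u v. (u, v) \<in> arcs t \<Longrightarrow> 1 \<le> u \<and> u < v \<and> v \<le> Suc k"
      "\<And>v. 2 \<le> v \<Longrightarrow> v \<le> Suc k \<Longrightarrow> \<exists>!u. (u, v) \<in> arcs t"
    using assms(1) by (auto simp: stratum_iff recursive_tree_iff)
  have a: "attach t v = \<lparr>nodes = {1..Suc (Suc k)}, arcs = insert (v, Suc (Suc k)) (arcs t)\<rparr>"
    using stratum_number_stratum[OF assms(1)] t(1)
    by (auto simp: attach_def Let_def)
  have "\<exists>!u. (u, w) \<in> insert (v, Suc (Suc k)) (arcs t)" if "2 \<le> w" "w \<le> Suc (Suc k)" for w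
  proof (cases "w = Suc (Suc k)")
    case True
    then show ?thesis using t(2) by fastforce
  next
    case False
    then show ?thesis using t(3)[of w] that by auto
  qed
  moreover have "\<forall>(u, w) \<in> insert (v, Suc (Suc k)) (arcs t). 1 \<le> u \<and> u < w \<and> w \<le> Suc (Suc k)"
    using assms(2) t(2) by (auto intro: le_SucI)
  ultimately show ?thesis
    by (simp add: stratum_iff recursive_tree_iff a)
qed

text \<open>The only arc into the largest label \<open>k + 2\<close> reveals the attachment point,
  and deleting it restores the old tree.\<close>

lemma bij_betw_attach:
  "bij_betw (\<lambda>(t, v). attach t v) (stratum k \<times> {1..Suc k}) (stratum (Suc k))"
proof (rule bij_betwI')
  let ?w = "Suc (Suc k)"
  have arcs: "arcs (attach t v) = insert (v, ?w) (arcs t)" if "t \<in> stratum k" for t v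
    using that by (simp add: attach_def Let_def stratum_number_stratum)
  have fresh: "(u, ?w) \<notin> arcs t" if "t \<in> stratum k" for t u
    using that by (fastforce simp: stratum_iff recursive_tree_iff)
  fix x y
  assume x: "x \<in> stratum k \<times> {1..Suc k}" and y: "y \<in> stratum k \<times> {1..Suc k}"
  obtain t v t' v' where [simp]: "x = (t, v)" "y = (t', v')"
    by fastforce
  have "x = y" if eq: "attach t v = attach t' v'"
  proof -
    have ins: "insert (v, ?w) (arcs t) = insert (v', ?w) (arcs t')"
      using eq arcs x y by (metis SigmaE2 \<open>x = (t, v)\<close> \<open>y = (t', v')\<close>)
    have "v = v'"
      using ins fresh[of t' v] y by auto
    moreover have "arcs t = arcs t'"
      using ins \<open>v = v'\<close> fresh x y by (metis SigmaE2 \<open>x = (t, v)\<close> \<open>y = (t', v')\<close> insert_ident)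
    moreover have "nodes t = nodes t'"
      using x y nodes_stratum[of _ k] by auto
    ultimately show ?thesis by simp
  qed
  then show "((case x of (t, v) \<Rightarrow> attach t v) = (case y of (t, v) \<Rightarrow> attach t v)) = (x = y)"
    by auto
next
  fix x assume "x \<in> stratum k \<times> {1..Suc k}"
  then show "(case x of (t, v) \<Rightarrow> attach t v) \<in> stratum (Suc k)"
    using attach_in_stratum by auto
next
  let ?w = "Suc (Suc k)"
  fix t assume "t \<in> stratum (Suc k)"
  then have t: "nodes t = {1..?w}" "\<And>u v. (u, v) \<in> arcs t \<Longrightarrow> 1 \<le> u \<and> u < v \<and> v \<le> ?w"
      "\<And>v. 2 \<le> v \<Longrightarrow> v \<le> ?w \<Longrightarrow> \<exists>!u. (u, v) \<in> arcs t"
    by (auto simp: stratum_iff recursive_tree_iff)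
  obtain u where u: "(u, ?w) \<in> arcs t" and unique: "\<And>u'. (u', ?w) \<in> arcs t \<Longrightarrow> u' = u"
    using t(3)[of ?w] by auto
  \<comment> \<open>The largest label is a leaf because labels increase along arcs, so only its
    incoming arc has to be removed.\<close>
  define s where "s = \<lparr>nodes = {1..Suc k}, arcs = arcs t - {(u, ?w)}\<rparr>"
  have "1 \<le> a \<and> a < b \<and> b \<le> Suc k" if "(a, b) \<in> arcs s" for a b
  proof -
    have "(a, b) \<in> arcs t" "b \<noteq> ?w"
      using that unique by (auto simp: s_def)
    with t(2)[of a b] show ?thesis by simp
  qed
  moreover have "\<exists>!a. (a, b) \<in> arcs s" if "2 \<le> b" "b \<le> Suc k" for b
    using t(3)[of b] that by (simp add: s_def)
  ultimately have s: "s \<in> stratum k"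
    by (auto simp: stratum_iff recursive_tree_iff s_def)
  moreover have "t = attach s u"
  proof -
    have "insert ?w {1..Suc k} = {1..?w}" by auto
    then show ?thesis
      using t(1) u stratum_number_stratum[OF s]
      by (auto simp: attach_def Let_def s_def insert_absorb)
  qed
  moreover have "u \<in> {1..Suc k}"
    using t(2)[OF u] by auto
  ultimately show "\<exists>x\<in>stratum k \<times> {1..Suc k}. t = (case x of (t, v) \<Rightarrow> attach t v)"
    by force
qed

lemma sum_stratum_Suc:
  "(\<Sum>t\<in>stratum (Suc k). f t) = (\<Sum>t\<in>stratum k. \<Sum>v\<in>{1..Suc k}. f (attach t v))"
proof -
  have "(\<Sum>t\<in>stratum (Suc k). f t) = (\<Sum>x\<in>stratum k \<times> {1..Suc k}. f (case x of (t, v) \<Rightarrow> attach t v))"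
    by (rule sum.reindex_bij_betw[OF bij_betw_attach, symmetric])
  then show ?thesis
    by (simp only: sum.cartesian_product case_prod_unfold)
qed

lemma card_stratum: "card (stratum k) = fact k"
proof (induction k)
  case (Suc k)
  with bij_betw_same_card[OF bij_betw_attach, of k] show ?case
    by (simp add: card_cartesian_product mult.commute)
qed (simp add: stratum_0)

section \<open>Leaf counts summed over a stratum\<close>

lemma leaves_attach:
  assumes "t \<in> stratum k" "v \<in> {1..Suc k}"
  shows "leaves (attach t v) = insert (Suc (Suc k)) (leaves t - {v})"
proof -
  have "(Suc (Suc k), w) \<notin> arcs t" for w
    using assms(1) by (fastforce simp: stratum_iff recursive_tree_iff)
  with assms show ?thesis
    using nodes_stratum[OF assms(1)] stratum_number_stratum[OF assms(1)]
    by (auto simp: leaves_def attach_def Let_def)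
qed

text \<open>Attaching to a leaf keeps the number \<open>l\<close> of leaves, attaching to an inner
  node raises it by one, so the total is \<open>(k + 1) (l + 1) - l\<close>.\<close>

lemma sum_leaves_attach:
  assumes t: "t \<in> stratum k"
  shows "(\<Sum>v\<in>{1..Suc k}. card (leaves (attach t v))) = Suc k + k * card (leaves t)"
proof -
  have sub: "leaves t \<subseteq> {1..Suc k}"
    using nodes_stratum[OF t] by (auto simp: leaves_def)
  then have fin: "finite (leaves t)"
    using finite_subset by blast
  \<comment> \<open>The lost leaf is added on the left to avoid truncated subtraction.\<close>
  have card: "card (leaves (attach t v)) + of_bool (v \<in> leaves t) = Suc (card (leaves t))"
    if v: "v \<in> {1..Suc k}" for v
  proof -
    have "card (leaves (attach t v)) = Suc (card (leaves t - {v}))"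
      using sub fin unfolding leaves_attach[OF t v]
      by (subst card_insert_disjoint) auto
    then show ?thesis
      using card_Suc_Diff1[OF fin, of v] by (cases "v \<in> leaves t") simp_all
  qed
  have "(\<Sum>v\<in>{1..Suc k}. card (leaves (attach t v))) + card (leaves t)
      = (\<Sum>v\<in>{1..Suc k}. card (leaves (attach t v)) + of_bool (v \<in> leaves t))"
    using sub by (simp add: sum.distrib Int_absorb1 del: sum.cl_ivl_Suc)
  also have "\<dots> = Suc k * Suc (card (leaves t))"
    by (simp add: card)
  finally show ?thesis by simp
qed

text \<open>The total \<open>A k\<close> satisfies
  \<open>A (k + 1) = (k + 1) * k! + k * A k\<close>. The factor 2 keeps the identity in the
  naturals; the indicator accounts for the single node being a leaf.\<close>

lemma sum_leaves_stratum:
  "2 * (\<Sum>t\<in>stratum k. card (leaves t)) = fact k * (1 + k + of_bool (k = 0))"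
proof (induction k)
  case 0
  have "leaves single_node_tree = {1}"
    by (auto simp: leaves_def single_node_tree_def)
  then show ?case by (simp add: stratum_0)
next
  case (Suc k)
  have "(\<Sum>t\<in>stratum (Suc k). card (leaves t)) = (\<Sum>t\<in>stratum k. Suc k + k * card (leaves t))"
    unfolding sum_stratum_Suc by (intro sum.cong refl sum_leaves_attach)
  also have "\<dots> = fact k * Suc k + k * (\<Sum>t\<in>stratum k. card (leaves t))"
    by (simp only: sum.distrib sum_distrib_left sum_constant card_stratum of_nat_id)
  finally have "2 * (\<Sum>t\<in>stratum (Suc k). card (leaves t))
      = 2 * (fact k * Suc k) + k * (2 * (\<Sum>t\<in>stratum k. card (leaves t)))"
    by simp
  \<comment> \<open>The factor \<open>k\<close> cancels the indicator of \<open>k = 0\<close>, so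
    the exceptional value at stratum 0 does not propagate.\<close>
  also have "\<dots> = 2 * (fact k * Suc k) + k * (fact k * (1 + k))"
    unfolding Suc.IH by (cases k) simp_all
  also have "\<dots> = fact (Suc k) * (1 + Suc k + of_bool (Suc k = 0))"
    by (cases k) (simp_all add: algebra_simps)
  finally show ?case .
qed

section \<open>Possible transitions and growth of the stratum number\<close>

lemma stratum_number_step:
  assumes d: "deletion_rule d" and s: "s \<in> recursive_trees" and t: "t \<in> set_pmf (step p d s)"
  shows "stratum_number t \<le> Suc (stratum_number s)"
proof -
  obtain k where k: "s \<in> stratum k"
    using s by (auto simp: recursive_trees_eq_Union_stratum)
  have "t \<in> set_pmf (uniform_attachment s) \<or> t = s \<or> s \<noteq> single_node_tree \<and> t \<in> set_pmf (d s)"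
    using t by (auto simp: step_def split: if_splits)
  then show ?thesis
  proof (elim disjE)
    assume "t \<in> set_pmf (uniform_attachment s)"
    then obtain v where "v \<in> {1..Suc k}" "t = attach s v"
      using nodes_stratum[OF k] by (auto simp: uniform_attachment_def)
    then show ?thesis
      using stratum_number_stratum[OF attach_in_stratum[OF k]] stratum_number_stratum[OF k] by simp
  next
    assume "s \<noteq> single_node_tree \<and> t \<in> set_pmf (d s)"
    \<comment> \<open>\<open>deletion_rule\<close> constrains \<open>d\<close> on positive strata;
      stratum 0 is excluded because its only tree is the single node.\<close>
    then obtain j where "k = Suc j" "t \<in> set_pmf (d s)"
      using k stratum_0 by (cases k) auto
    then have "t \<in> stratum j"
      using d k by (auto simp: deletion_rule_def)
    then show ?thesis
      using \<open>k = Suc j\<close> k by (simp add: stratum_number_stratum)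
  qed simp
qed

context recursive_tree_process
begin

lemma T_in_recursive_trees: "\<omega> \<in> space M \<Longrightarrow> T n \<omega> \<in> recursive_trees"
  using random_tree[of n] by (auto simp: measurable_def)

lemma sets_Collect_T [measurable]: "{\<omega> \<in> space M. P (T n \<omega>)} \<in> sets M"
proof -
  have "{\<omega> \<in> space M. P (T n \<omega>)} = T n -` {t \<in> recursive_trees. P t} \<inter> space M"
    using T_in_recursive_trees by auto
  also have "\<dots> \<in> sets M"
    by (rule measurable_sets[OF random_tree]) auto
  finally show ?thesis .
qed

lemma borel_measurable_T [measurable]: "(\<lambda>\<omega>. f (T n \<omega>) :: real) \<in> borel_measurable M"
  by (rule measurable_compose[OF random_tree]) simp

text \<open>Turns the Markov property into a statement about sample paths. A history followed by an
  impossible successor is a null event: by \<open>markov\<close> if the history has positive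
  probability, by monotonicity otherwise.\<close>

lemma AE_T_Suc_in_set_pmf_step: "AE \<omega> in M. T (Suc n) \<omega> \<in> set_pmf (step p d (T n \<omega>))"
proof -
  let ?H = "{..n} \<rightarrow>\<^sub>E recursive_trees"
  define Hist where "Hist h \<omega> \<longleftrightarrow> (\<forall>i\<le>n. T i \<omega> = h i)" for h \<omega>
  have meas [measurable]: "{\<omega> \<in> space M. Hist h \<omega>} \<in> sets M" for h
    unfolding Hist_def by measurable
  \<comment> \<open>The Markov property only speaks about single histories, but these form a countable set.\<close>
  have "countable (?H \<times> recursive_trees)"
    by (intro countable_SIGMA countable_PiE countable_recursive_trees) simp
  moreover have "AE \<omega> in M. Hist h \<omega> \<longrightarrow> T (Suc n) \<omega> = t \<longrightarrow> t \<in> set_pmf (step p d (h n))" for h t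
  proof (cases "t \<in> set_pmf (step p d (h n))")
    case False
    have "\<P>(\<omega> in M. T (Suc n) \<omega> = t \<and> Hist h \<omega>) = 0"
    proof (cases "\<P>(\<omega> in M. Hist h \<omega>) > 0")
      case True
      then have "\<P>(\<omega> in M. T (Suc n) \<omega> = t \<bar> Hist h \<omega>) = 0"
        using markov[of n h t] False by (simp add: Hist_def set_pmf_iff)
      with True show ?thesis
        by (simp add: cond_prob_def)
    next
      case null: False
      have "\<P>(\<omega> in M. T (Suc n) \<omega> = t \<and> Hist h \<omega>) \<le> \<P>(\<omega> in M. Hist h \<omega>)"
        by (intro finite_measure_mono) auto
      with null show ?thesis
        by (smt (verit) measure_nonneg)
    qed
    then have "AE \<omega> in M. \<not> (T (Suc n) \<omega> = t \<and> Hist h \<omega>)"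
      by (subst (asm) prob_eq_0) (auto intro: sets.sets_Collect)
    then show ?thesis
      by eventually_elim auto
  qed simp
  ultimately have "AE \<omega> in M. \<forall>x\<in>?H \<times> recursive_trees.
      Hist (fst x) \<omega> \<longrightarrow> T (Suc n) \<omega> = snd x \<longrightarrow> snd x \<in> set_pmf (step p d (fst x n))"
    by (subst AE_ball_countable) auto
  with AE_space show ?thesis
  proof eventually_elim
    case (elim \<omega>)
    \<comment> \<open>The realised path is restricted to \<open>{..n}\<close> so that it lies in the
      extensional function space \<open>?H\<close>.\<close>
    then show ?case
      using elim(2)[rule_format, of "(restrict (\<lambda>i. T i \<omega>) {..n}, T (Suc n) \<omega>)"]
        T_in_recursive_trees[OF elim(1)] by (simp add: Hist_def)
  qed
qed

text \<open>The chain starts in stratum 0 and climbs at most one stratum per step; thus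
  \<open>T n\<close> almost surely takes values in a finite set.\<close>

lemma AE_stratum_number_le: "AE \<omega> in M. stratum_number (T n \<omega>) \<le> n"
proof (induction n)
  case 0
  from initial show ?case
    by eventually_elim (simp add: stratum_number_def single_node_tree_def)
next
  case (Suc n)
  with AE_T_Suc_in_set_pmf_step[of n] AE_space show ?case
  proof eventually_elim
    case (elim \<omega>)
    then show ?case
      using stratum_number_step[OF deletion_rule T_in_recursive_trees] by fastforce
  qed
qed

section \<open>Expectations as finite sums over strata\<close>

lemma AE_T_eq_sum:
  fixes f :: "labelled_tree \<Rightarrow> real"
  shows "AE \<omega> in M. f (T n \<omega>) =
    (\<Sum>k\<le>n. \<Sum>t\<in>stratum k. f t * indicator {\<omega> \<in> space M. T n \<omega> = t} \<omega>)"
  using AE_stratum_number_le[of n] AE_space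
proof eventually_elim
  case (elim \<omega>)
  \<comment> \<open>The double sum is flattened to isolate its one nonzero term: a tree determines
    its stratum, so only the pair \<open>?x\<close> has second component
    \<open>T n \<omega>\<close>.\<close>
  define F where "F = (SIGMA k:{..n}. stratum k)"
  let ?x = "(stratum_number (T n \<omega>), T n \<omega>)"
  have "?x \<in> F"
    using elim T_in_recursive_trees by (auto simp: F_def stratum_def)
  moreover have "finite F"
    by (simp add: F_def finite_stratum)
  moreover have "snd x \<noteq> T n \<omega>" if "x \<in> F - {?x}" for x
    using that by (cases x) (auto simp: F_def stratum_number_stratum)
  then have "(F - {?x}) \<inter> {x. T n \<omega> = snd x} = {}"
    by fastforce
  ultimately have "(\<Sum>x\<in>F. f (snd x) * indicator {\<omega> \<in> space M. T n \<omega> = snd x} \<omega>) = f (T n \<omega>)"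
    using elim by (subst sum.remove[of F ?x]) (simp_all add: indicator_def)
  then show ?case
    by (subst sum.Sigma) (simp_all add: F_def finite_stratum case_prod_unfold)
qed

lemma integrable_T_eq: "integrable M (indicat_real {\<omega> \<in> space M. T n \<omega> = t})"
  by (simp add: emeasure_eq_measure)

lemma integrable_T: "integrable M (\<lambda>\<omega>. f (T n \<omega>) :: real)"
  by (subst integrable_cong_AE[OF _ _ AE_T_eq_sum])
    (auto intro!: Bochner_Integration.integrable_sum integrable_T_eq)

lemma expectation_T:
  fixes f :: "labelled_tree \<Rightarrow> real"
  shows "expectation (\<lambda>\<omega>. f (T n \<omega>)) = (\<Sum>k\<le>n. \<Sum>t\<in>stratum k. f t * \<P>(\<omega> in M. T n \<omega> = t))"
  by (subst integral_cong_AE[OF _ _ AE_T_eq_sum])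
    (auto simp: Bochner_Integration.integral_sum integrable_T_eq)

text \<open>For \<open>n \<ge> 1\<close> the common value is the probability of stratum
  \<open>k\<close> divided by \<open>k!\<close>. Conditional equiprobability says nothing about
  \<open>n = 0\<close>, where the law is the point mass at the single-node tree.\<close>

lemma prob_T_uniform_on_stratum:
  assumes "conditionally_equiprobable M T"
  obtains c where "\<And>k t. t \<in> stratum k \<Longrightarrow> \<P>(\<omega> in M. T n \<omega> = t) = c k"
proof (cases "n = 0")
  case True
  have "\<P>(\<omega> in M. T n \<omega> = t) = of_bool (k = 0)" if "t \<in> stratum k" for k t
  proof (cases "k = 0")
    case True
    then show ?thesis
      using that initial \<open>n = 0\<close> stratum_0 by (simp add: prob_Collect_eq_1)
  next
    case False
    then have "t \<noteq> single_node_tree"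
      using that stratum_number_stratum[of single_node_tree 0] stratum_0
      by (metis insertI1 stratum_number_stratum)
    then have "AE \<omega> in M. T n \<omega> \<noteq> t"
      using initial \<open>n = 0\<close> by auto
    with False show ?thesis
      by (simp add: prob_Collect_eq_0)
  qed
  then show thesis by (rule that)
next
  case False
  let ?P = "\<lambda>k. \<P>(\<omega> in M. stratum_number (T n \<omega>) = k)"
  have "\<P>(\<omega> in M. T n \<omega> = t) = ?P k / fact k" if t: "t \<in> stratum k" for k t
  proof (cases "?P k > 0")
    case True
    then have "\<P>(\<omega> in M. T n \<omega> = t \<bar> stratum_number (T n \<omega>) = k) = 1 / fact k"
      using assms t False by (auto simp: conditionally_equiprobable_def)
    moreover have "{\<omega> \<in> space M. T n \<omega> = t \<and> stratum_number (T n \<omega>) = k} = {\<omega> \<in> space M. T n \<omega> = t}"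
      using t by (auto simp: stratum_number_stratum)
    ultimately show ?thesis
      using True by (simp add: cond_prob_def field_simps)
  next
    \<comment> \<open>Each tree of a null stratum is itself null, and the formula
      \<open>?P k / fact k\<close> also gives 0.\<close>
    case null: False
    have "\<P>(\<omega> in M. T n \<omega> = t) \<le> ?P k"
      using t by (intro finite_measure_mono) (auto simp: stratum_number_stratum)
    with null show ?thesis
      by (smt (verit) measure_nonneg div_0)
  qed
  then show thesis by (rule that)
qed

end

theorem mainTheorem13:
  fixes M :: "'a measure"
    and p :: real
    and d :: "labelled_tree \<Rightarrow> labelled_tree pmf"
    and T :: "nat \<Rightarrow> 'a \<Rightarrow> labelled_tree"
    and n :: nat
  assumes "0 < p" and "p < 1"
    and "recursive_tree_process M p d T"
    and "conditionally_equiprobable M T"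
  shows "(\<integral>\<omega>. real (card (leaves (T n \<omega>))) \<partial>M) =
    (1 + (\<integral>\<omega>. real (stratum_number (T n \<omega>)) \<partial>M)
       + \<P>(\<omega> in M. stratum_number (T n \<omega>) = 0)) / 2"
proof -
  interpret recursive_tree_process M p d T
    by fact
  let ?L = "\<lambda>t. real (card (leaves t))"
  let ?S = "\<lambda>t. real (stratum_number t)"
  let ?Z = "\<lambda>t. of_bool (stratum_number t = 0) :: real"
  \<comment> \<open>The defect of the claimed identity at a single tree; the leaf count makes it sum
    to zero over every stratum.\<close>
  let ?g = "\<lambda>t. 2 * ?L t - (1 + ?S t + ?Z t)"
  obtain c where c: "\<And>k t. t \<in> stratum k \<Longrightarrow> \<P>(\<omega> in M. T n \<omega> = t) = c k"
    using prob_T_uniform_on_stratum assms(4) by blast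
  have stratum_sum: "(\<Sum>t\<in>stratum k. ?g t) = 0" for k
  proof -
    have "(\<Sum>t\<in>stratum k. ?g t)
        = real (2 * (\<Sum>t\<in>stratum k. card (leaves t))) - (\<Sum>t\<in>stratum k. 1 + real k + of_bool (k = 0))"
      by (simp add: sum_subtractf sum_distrib_left stratum_number_stratum)
    also have "\<dots> = 0"
      unfolding sum_leaves_stratum by (simp add: card_stratum algebra_simps)
    finally show ?thesis .
  qed
  have "expectation (\<lambda>\<omega>. ?g (T n \<omega>)) = (\<Sum>k\<le>n. \<Sum>t\<in>stratum k. ?g t * c k)"
    unfolding expectation_T[of ?g] by (simp add: c)
  \<comment> \<open>\<open>c k\<close> factors out of the sum over stratum \<open>k\<close>, so each
    stratum contributes zero whatever its weight.\<close>
  also have "\<dots> = 0"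
    by (simp add: stratum_sum flip: sum_distrib_right)
  \<comment> \<open>Integrability of the three terms allows the vanishing expectation to be split by
    linearity.\<close>
  finally have "2 * expectation (\<lambda>\<omega>. ?L (T n \<omega>))
      = 1 + expectation (\<lambda>\<omega>. ?S (T n \<omega>)) + expectation (\<lambda>\<omega>. ?Z (T n \<omega>))"
    using integrable_T[of ?L n] integrable_T[of ?S n] integrable_T[of ?Z n] by (simp add: prob_space)
  moreover have "expectation (\<lambda>\<omega>. ?Z (T n \<omega>)) = \<P>(\<omega> in M. stratum_number (T n \<omega>) = 0)"
  proof -
    have "expectation (\<lambda>\<omega>. ?Z (T n \<omega>))
        = expectation (indicator {\<omega> \<in> space M. stratum_number (T n \<omega>) = 0})"
      by (intro Bochner_Integration.integral_cong) (auto simp: indicator_def)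
    then show ?thesis by simp
  qed
  ultimately show ?thesis by simp
qed

end
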